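(* For $\boldsymbol{n} = (n_1,n_2,n_3,n_4) \in \mathbb{Z}^4$ define $$A(\boldsymbol{n}) = \sum_{k \in \mathbb{Z}} \binom{n_1}{k}\binom{n_3}{k}\binom{n_1+n_2-k}{n_1}\binom{n_3+n_4-k}{n_3}$$ (this sum has only finitely many nonzero terms). Then for all primes $p \geq 5$, all integers $r \geq 1$ and all $\boldsymbol{n} \in \mathbb{Z}^4$, $$A(p^r \boldsymbol{n}) \equiv A(p^{r-1}\boldsymbol{n}) \pmod{p^{3r}}.$$
   Context: For all integers $n, k$, the binomial coefficient is defined by $\binom{n}{k} = \lim_{z \to 0} \frac{\Gamma(z+n+1)}{\Gamma(z+k+1)\Gamma(z+n-k+1)}$. This is a finite integer for all $n,k\in\mathbb{Z}$, agrees with the usual binomial coefficient for $n \ge 0$, satisfies $\binom{n}{k}=\binom{n}{n-k}$, and for integers is nonzero only if ($k\ge0$ and $n-k\ge0$) or ($n<0$ and $k\ge 0$) or ($n<0$ and $n-k\ge0$); e.g. $\binom{-3}{-5}=\binom{-3}{2}=6$. For nonnegative $\boldsymbol{n}$, $A(\boldsymbol{n})$ is the coefficient of $x_1^{n_1}x_2^{n_2}x_3^{n_3}x_4^{n_4}$ in $1/((1-x_1-x_2)(1-x_3-x_4)-x_1x_2x_3x_4)$. *)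

theory Defs
  imports Complex_Main "HOL-Computational_Algebra.Primes" "HOL-Number_Theory.Cong"
begin

text \<open>Binomial coefficient for all integers n, k (the Gamma-limit convention of the paper):
  for k >= 0 it is the generalized binomial n(n-1)...(n-k+1)/k! (computed in rat; it is an integer); for k < 0 it is given by
  the symmetry binom(n,k) = binom(n,n-k) when n-k >= 0, and is 0 otherwise.\<close>
definition ibinom :: "int \<Rightarrow> int \<Rightarrow> int" where
  "ibinom n k =
     (if k \<ge> 0 then floor ((of_int n :: rat) gchoose (nat k))
      else if n - k \<ge> 0 then floor ((of_int n :: rat) gchoose (nat (n - k)))
      else 0)"

definition A_term :: "int \<Rightarrow> int \<Rightarrow> int \<Rightarrow> int \<Rightarrow> int \<Rightarrow> int" where
  "A_term n1 n2 n3 n4 k =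
     ibinom n1 k * ibinom n3 k * ibinom (n1 + n2 - k) n1 * ibinom (n3 + n4 - k) n3"

text \<open>Sum over all k in Z; only finitely many terms are nonzero.\<close>
definition A :: "int \<Rightarrow> int \<Rightarrow> int \<Rightarrow> int \<Rightarrow> int" where
  "A n1 n2 n3 n4 = (\<Sum>k \<in> {k. A_term n1 n2 n3 n4 k \<noteq> 0}. A_term n1 n2 n3 n4 k)"

end

theory Submission
  imports Defs "HOL-Number_Theory.Residues"
begin

text \<open>
  Write \<open>T\<^sub>r k\<close> for the summand of \<open>A (p\<^sup>r n)\<close>. All binomials are compared with those at the
  quotients by \<open>p\<close>: if no carry occurs at the last digit, the ratio of \<open>n choose k\<close> and
  \<open>n div p choose k div p\<close> equals the product of the non-multiples of \<open>p\<close> between \<open>n - k\<close> and \<open>n\<close>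
  divided by that between \<open>0\<close> and \<open>k\<close>.

  If \<open>p\<close> divides \<open>k\<close>, then \<open>T\<^sub>r k\<close> is congruent to \<open>T\<^sub>r\<^sub>-\<^sub>1 (k / p)\<close>: with \<open>s \<le> r\<close> the largest
  exponent such that \<open>p\<^sup>s\<close> divides \<open>k\<close>, each of the four binomials changes by a factor congruent
  to 1 modulo \<open>p\<close> to the power \<open>r + 2 s\<close> (Jacobsthal, Kazandzidis), and the first two contribute
  another factor \<open>p\<close> to the power \<open>2 (r - s)\<close>.

  If \<open>p\<close> does not divide \<open>k\<close>, absorption gives \<open>k\<^sup>2 T\<^sub>r k = p\<^sup>2\<^sup>r n\<^sub>1 n\<^sub>3 C\<^sub>r (k - 1)\<close> with
  \<open>C\<^sub>r i \<equiv> C\<^sub>r\<^sub>-\<^sub>1 (i div p)\<close> modulo \<open>p\<^sup>r\<close>. Summing by parts over blocks of length \<open>p\<^sup>s\<close>, on which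
  the inverse squares sum to 0 modulo \<open>p\<^sup>s\<close> because \<open>p \<ge> 5\<close>, shows that the sum of these
  \<open>C\<^sub>r (k - 1) / k\<^sup>2\<close> vanishes modulo \<open>p\<^sup>r\<close> (Beukers).
\<close>

section \<open>Congruence of ratios\<close>

lemma cong_mult_of_dvd:
  fixes x y z :: "'a :: unique_euclidean_ring"
  assumes "[x = y] (mod m)" "d dvd z"
  shows "[x * z = y * z] (mod m * d)"
  using mult_dvd_mono[of m "x - y" d z] assms by (simp add: cong_iff_dvd_diff left_diff_distrib)

text \<open>Says that \<open>x / y\<close> is congruent to 1, which is stronger than \<open>x \<equiv> y\<close> if \<open>p\<close> divides \<open>y\<close>.\<close>

definition ratio_cong_1 :: "int \<Rightarrow> nat \<Rightarrow> int \<Rightarrow> int \<Rightarrow> bool" where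
  "ratio_cong_1 p e x y \<longleftrightarrow> (\<exists>u v. coprime u p \<and> [u = v] (mod p ^ e) \<and> x * u = y * v)"

lemma ratio_cong_1_mult:
  assumes "ratio_cong_1 p e x y" "ratio_cong_1 p e x' y'"
  shows "ratio_cong_1 p e (x * x') (y * y')"
proof -
  obtain u v where uv: "coprime u p" "[u = v] (mod p ^ e)" "x * u = y * v"
    using assms(1) unfolding ratio_cong_1_def by blast
  obtain u' v' where uv': "coprime u' p" "[u' = v'] (mod p ^ e)" "x' * u' = y' * v'"
    using assms(2) unfolding ratio_cong_1_def by blast
  have "x * x' * (u * u') = (x * u) * (x' * u')" by (simp only: mult_ac)
  also have "\<dots> = y * y' * (v * v')" unfolding uv(3) uv'(3) by (simp only: mult_ac)
  finally have "x * x' * (u * u') = y * y' * (v * v')" .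
  moreover have "coprime (u * u') p" "[u * u' = v * v'] (mod p ^ e)"
    using uv(1,2) uv'(1,2) by (simp_all add: cong_mult)
  ultimately show ?thesis unfolding ratio_cong_1_def by blast
qed

lemma ratio_cong_1_imp_cong:
  assumes "ratio_cong_1 p e x y" "p ^ f dvd y"
  shows "[x = y] (mod p ^ (e + f))"
proof -
  obtain u v where "coprime u p" and uv: "[u = v] (mod p ^ e)" "x * u = y * v"
    using assms(1) unfolding ratio_cong_1_def by blast
  have "[v * y = u * y] (mod p ^ e * p ^ f)"
    by (rule cong_mult_of_dvd[OF cong_sym[OF uv(1)] assms(2)])
  hence "[x * u = y * u] (mod p ^ (e + f))" unfolding uv(2) power_add by (simp add: mult.commute)
  thus ?thesis using \<open>coprime u p\<close> by (simp add: cong_mult_rcancel)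
qed

section \<open>Integer intervals and divisibility\<close>

lemma greaterThanAtMost_pred_self: "{k - 1<..k} = {k}" for k :: int
  by auto

lemma le_div_iff_mult_le:
  fixes i j p :: int
  assumes "0 < p"
  shows "j \<le> i div p \<longleftrightarrow> p * j \<le> i"
proof
  assume "j \<le> i div p"
  hence "p * j \<le> p * (i div p)" using assms by simp
  also have "\<dots> \<le> i" using mult_div_mod_eq[of p i] pos_mod_sign[OF assms, of i] by linarith
  finally show "p * j \<le> i" .
next
  assume "p * j \<le> i"
  thus "j \<le> i div p" using zdiv_mono1[of "p * j" i p] assms by simp
qed

lemma mult_minus_one_minus_div:
  fixes i m p :: int
  assumes "0 < p"
  shows "(p * m - 1 - i) div p = m - 1 - i div p"
proof (rule int_div_pos_eq)
  show "p * m - 1 - i = p * (m - 1 - i div p) + (p - 1 - i mod p)"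
    using mult_div_mod_eq[of p i] by (simp add: algebra_simps)
  show "0 \<le> p - 1 - i mod p" "p - 1 - i mod p < p"
    using pos_mod_sign[OF assms, of i] pos_mod_bound[OF assms, of i] by linarith+
qed

lemma pred_div_eq_pred_iff:
  fixes j k p :: int
  assumes "0 < p"
  shows "(k - 1) div p = j - 1 \<longleftrightarrow> k \<in> {p * (j - 1)<..p * j}"
  using le_div_iff_mult_le[OF assms, of "j - 1" "k - 1"] le_div_iff_mult_le[OF assms, of j "k - 1"]
  by (simp only: greaterThanAtMost_iff) linarith

lemma sum_blocks:
  fixes p a b :: int
  assumes "0 < p"
  shows "(\<Sum>i\<in>{p * a<..p * b}. f i) = (\<Sum>j\<in>{a<..b}. \<Sum>i\<in>{p * (j - 1)<..p * j}. f i)"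
proof -
  define g where "g i = (i - 1) div p + 1" for i
  have g_eq: "g i = j \<longleftrightarrow> i \<in> {p * (j - 1)<..p * j}" for i j
    unfolding pred_div_eq_pred_iff[OF assms, symmetric] g_def by linarith
  have g_gt: "j < g i \<longleftrightarrow> p * j < i" for i j
    using le_div_iff_mult_le[OF assms, of j "i - 1"] by (simp only: g_def) linarith
  hence g_le: "g i \<le> j \<longleftrightarrow> i \<le> p * j" for i j by (meson not_less)
  have "(\<Sum>i\<in>{p * a<..p * b}. f i) =
      (\<Sum>j\<in>{a<..b}. \<Sum>i\<in>{i \<in> {p * a<..p * b}. g i = j}. f i)"
    by (intro sum.group[symmetric]) (auto simp: g_gt g_le)
  also have "{i \<in> {p * a<..p * b}. g i = j} = {p * (j - 1)<..p * j}" if "j \<in> {a<..b}" for j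
  proof -
    have "p * a \<le> p * (j - 1)" "p * j \<le> p * b"
      using that assms by (auto intro!: mult_left_mono)
    thus ?thesis unfolding g_eq by auto
  qed
  hence "(\<Sum>j\<in>{a<..b}. \<Sum>i\<in>{i \<in> {p * a<..p * b}. g i = j}. f i) =
      (\<Sum>j\<in>{a<..b}. \<Sum>i\<in>{p * (j - 1)<..p * j}. f i)" by simp
  finally show ?thesis .
qed

lemma bij_betw_mult_mod:
  fixes a c m :: int
  assumes "0 < m" "coprime c m"
  shows "bij_betw (\<lambda>i. (c * i) mod m) {a<..a + m} {0..<m}"
proof -
  have inj: "inj_on (\<lambda>i. (c * i) mod m) {a<..a + m}"
  proof (rule inj_onI)
    fix x y assume xy: "x \<in> {a<..a + m}" "y \<in> {a<..a + m}" "(c * x) mod m = (c * y) mod m"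
    hence "m dvd c * (x - y)" by (simp add: mod_eq_dvd_iff right_diff_distrib)
    hence "m dvd x - y"
      using assms(2) by (simp add: coprime_dvd_mult_right_iff coprime_commute)
    moreover have "\<bar>x - y\<bar> < m" using xy by auto
    ultimately show "x = y" using dvd_imp_le_int[of "x - y" m] assms by (cases "x = y") auto
  qed
  moreover have "(\<lambda>i. (c * i) mod m) ` {a<..a + m} = {0..<m}"
    by (rule card_subset_eq) (use assms in \<open>auto simp: card_image[OF inj]\<close>)
  ultimately show ?thesis by (simp add: bij_betw_def)
qed

definition nonmultiples :: "int \<Rightarrow> int \<Rightarrow> int \<Rightarrow> int set" where
  "nonmultiples p a b = {i \<in> {a<..b}. \<not> p dvd i}"

lemma finite_nonmultiples [simp]: "finite (nonmultiples p a b)"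
  unfolding nonmultiples_def by (rule finite_subset[of _ "{a<..b}"]) auto

lemma multiples_greaterThanAtMost:
  fixes p a b :: int
  assumes "0 < p"
  shows "{i \<in> {a<..b}. p dvd i} = (\<lambda>j. p * j) ` {a div p<..b div p}"
proof -
  have "p * j \<in> {a<..b} \<longleftrightarrow> j \<in> {a div p<..b div p}" for j
    using le_div_iff_mult_le[OF assms, of j a] le_div_iff_mult_le[OF assms, of j b] by auto
  thus ?thesis unfolding dvd_def by blast
qed

lemma (in comm_monoid_set) split_multiples:
  fixes p a b :: int
  assumes "0 < p"
  shows "F g {a<..b} = F (\<lambda>j. g (p * j)) {a div p<..b div p} \<^bold>* F g (nonmultiples p a b)"
proof -
  let ?M = "(\<lambda>j. p * j) ` {a div p<..b div p}"
  have "{a<..b} = ?M \<union> nonmultiples p a b"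
    unfolding multiples_greaterThanAtMost[OF assms, symmetric] by (auto simp: nonmultiples_def)
  also have "F g \<dots> = F g ?M \<^bold>* F g (nonmultiples p a b)"
    by (rule union_disjoint) (simp_all, auto simp: nonmultiples_def)
  also have "F g ?M = F (\<lambda>j. g (p * j)) {a div p<..b div p}"
    using assms by (subst reindex) (auto simp: inj_on_def o_def)
  finally show ?thesis .
qed

lemma card_nonmultiples:
  assumes "0 < p" "0 \<le> k"
  shows "int (card (nonmultiples p 0 k)) = k - k div p"
proof -
  have "nat k = nat (k div p) + card (nonmultiples p 0 k)"
    using sum.split_multiples[OF assms(1), of "\<lambda>_. 1::nat" 0 k] by simp
  moreover have "0 \<le> k div p" using assms by (simp add: pos_imp_zdiv_nonneg_iff)
  ultimately show ?thesis using assms(2) by linarith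
qed

section \<open>Inverse squares modulo a prime power\<close>

lemma sum_power_complete_residues_dvd:
  fixes a c m :: int
  assumes "0 < m" "coprime c m" "coprime (c ^ e - 1) m"
  shows "m dvd (\<Sum>i\<in>{a<..a + m}. i ^ e)"
proof -
  let ?S = "\<Sum>i\<in>{a<..a + m}. i ^ e"
  have permute: "[d ^ e * ?S = (\<Sum>i\<in>{0..<m}. i ^ e)] (mod m)" if "coprime d m" for d
  proof -
    have "d ^ e * ?S = (\<Sum>i\<in>{a<..a + m}. (d * i) ^ e)"
      by (simp add: power_mult_distrib sum_distrib_left)
    also have "[\<dots> = (\<Sum>i\<in>{a<..a + m}. ((d * i) mod m) ^ e)] (mod m)"
      by (intro cong_sum cong_pow) (simp add: cong_def)
    also have "(\<Sum>i\<in>{a<..a + m}. ((d * i) mod m) ^ e) = (\<Sum>i\<in>{0..<m}. i ^ e)"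
      by (rule sum.reindex_bij_betw[OF bij_betw_mult_mod[OF assms(1) that]])
    finally show ?thesis .
  qed
  have "[c ^ e * ?S = ?S] (mod m)"
    using permute[OF assms(2)] permute[of 1] by (auto simp: cong_def)
  hence "m dvd (c ^ e - 1) * ?S" by (simp add: cong_iff_dvd_diff algebra_simps)
  thus ?thesis using assms(3) by (simp add: coprime_dvd_mult_right_iff coprime_commute)
qed

text \<open>By Euler's theorem this is the inverse of \<open>k\<^sup>2\<close> modulo \<open>p ^ r\<close> if \<open>p\<close> does not divide \<open>k\<close>.
  The exponent is at least \<open>r\<close>, so that multiples of \<open>p\<close> are mapped to 0 modulo \<open>p ^ r\<close>.\<close>

definition inv_square :: "int \<Rightarrow> nat \<Rightarrow> int \<Rightarrow> int" where
  "inv_square p r k = k ^ (totient (nat (p ^ r)) * (r + 2) - 2)"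

context
  fixes p :: int and r :: nat
  assumes prime_p: "prime p"
begin

lemma inv_square_exponent_ge: "r + 2 \<le> totient (nat (p ^ r)) * (r + 2)"
proof -
  have "1 \<le> totient (nat (p ^ r))"
    using prime_gt_0_int[OF prime_p] by (simp add: Suc_le_eq)
  thus ?thesis using mult_le_mono1[of 1 "totient (nat (p ^ r))" "r + 2"] by (simp only: mult_1)
qed

lemma inv_square_inverse:
  assumes "\<not> p dvd k"
  shows "[k ^ 2 * inv_square p r k = 1] (mod p ^ r)"
proof (cases "r = 0")
  case False
  let ?t = "totient (nat (p ^ r))"
  have "residues (p ^ r)"
    using prime_gt_1_int[OF prime_p] False by (simp add: residues_def)
  moreover have "coprime k (p ^ r)" by (rule prime_imp_power_coprime[OF prime_p assms])
  ultimately have "[k ^ ?t = 1] (mod p ^ r)" by (rule residues.euler_theorem)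
  hence "[(k ^ ?t) ^ (r + 2) = 1 ^ (r + 2)] (mod p ^ r)" by (rule cong_pow)
  moreover have "2 + (?t * (r + 2) - 2) = ?t * (r + 2)" using inv_square_exponent_ge by linarith
  ultimately show ?thesis
    unfolding inv_square_def power_add[symmetric] by (simp only: power_mult power_one)
qed auto

lemma inv_square_multiple:
  assumes "p dvd k"
  shows "p ^ r dvd inv_square p r k"
proof -
  have "r \<le> totient (nat (p ^ r)) * (r + 2) - 2" using inv_square_exponent_ge by linarith
  thus ?thesis unfolding inv_square_def by (rule dvd_power_le[OF assms])
qed

lemma inv_square_sum_block:
  assumes "5 \<le> p" "s \<le> r"
  shows "p ^ s dvd (\<Sum>i\<in>{a<..a + p ^ s}. inv_square p r i)"
proof (cases "r = 0")
  case False
  define e where "e = totient (nat (p ^ r)) * (r + 2) - 2"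
  have not_dvd: "\<not> p dvd 2" "\<not> p dvd 3" using assms(1) by (auto dest: zdvd_imp_le)
  have "[4 * 2 ^ e = 1] (mod p ^ r)"
    using inv_square_inverse[OF not_dvd(1)] by (simp add: inv_square_def e_def)
  hence "[4 * 2 ^ e = 1] (mod p)" by (rule cong_dvd_modulus) (use False in simp)
  hence "p dvd 4 * 2 ^ e - 1" by (simp add: cong_iff_dvd_diff)
  hence "p dvd (4 * 2 ^ e - 1) - 4 * (2 ^ e - 1)" if "p dvd 2 ^ e - 1"
    using that by (rule dvd_diff[OF _ dvd_mult])
  hence "\<not> p dvd 2 ^ e - 1" using not_dvd(2) by auto
  hence "coprime (2 ^ e - 1) (p ^ s)" "coprime 2 (p ^ s)"
    using not_dvd(1) prime_imp_power_coprime[OF prime_p] by blast+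
  moreover have "0 < p ^ s" using assms(1) by simp
  ultimately show ?thesis
    unfolding inv_square_def e_def[symmetric] by (intro sum_power_complete_residues_dvd)
qed (use assms in simp)

end

lemma inv_square_sum_nonmultiples:
  assumes "prime p" "5 \<le> p" "p ^ s dvd a" "p ^ s dvd b"
  shows "p ^ s dvd (\<Sum>i\<in>nonmultiples p a b. inv_square p s i)"
proof -
  have "0 < p" using assms(2) by simp
  obtain a' b' where bounds: "a = p ^ s * a'" "b = p ^ s * b'" using assms(3,4) by blast
  have "p ^ s dvd (\<Sum>i\<in>{p ^ s * (j - 1)<..p ^ s * j}. inv_square p s i)" for j
    using inv_square_sum_block[OF assms(1,2) order_refl, of s "p ^ s * (j - 1)"]
    by (simp add: right_diff_distrib)
  hence "p ^ s dvd (\<Sum>i\<in>{a<..b}. inv_square p s i)"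
    unfolding bounds using \<open>0 < p\<close> by (subst sum_blocks) (simp_all add: dvd_sum)
  moreover have "p ^ s dvd (\<Sum>j\<in>{a div p<..b div p}. inv_square p s (p * j))"
    by (intro dvd_sum inv_square_multiple[OF assms(1)]) simp
  ultimately show ?thesis
    using sum.split_multiples[OF \<open>0 < p\<close>, of "inv_square p s" a b] by (simp add: dvd_add_right_iff)
qed

section \<open>Products of the non-multiples of a prime\<close>

definition nonmultiple_prod :: "int \<Rightarrow> int \<Rightarrow> int \<Rightarrow> int" where
  "nonmultiple_prod p a b = \<Prod>(nonmultiples p a b)"

lemma nonmultiple_prod_refl [simp]: "nonmultiple_prod p a a = 1"
  by (simp add: nonmultiple_prod_def nonmultiples_def)

lemma coprime_nonmultiple_prod:
  assumes "prime p"
  shows "coprime (nonmultiple_prod p a b) p"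
  unfolding nonmultiple_prod_def using prime_imp_coprime[OF assms]
  by (intro prod_coprime_left) (auto simp: nonmultiples_def coprime_commute)

lemma prod_greaterThanAtMost_split_multiples:
  assumes "0 < p"
  shows "\<Prod>{a<..b} = p ^ nat (b div p - a div p) * \<Prod>{a div p<..b div p} * nonmultiple_prod p a b"
  using prod.split_multiples[OF assms, of "\<lambda>i. i" a b]
  by (simp add: prod.distrib nonmultiple_prod_def)

lemma nonmultiple_prod_concat:
  assumes "a \<le> b" "b \<le> c"
  shows "nonmultiple_prod p a b * nonmultiple_prod p b c = nonmultiple_prod p a c"
proof -
  have "nonmultiples p a c = nonmultiples p a b \<union> nonmultiples p b c"
    using assms by (auto simp: nonmultiples_def)
  moreover have "nonmultiples p a b \<inter> nonmultiples p b c = {}"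
    by (auto simp: nonmultiples_def)
  ultimately show ?thesis by (simp add: nonmultiple_prod_def prod.union_disjoint)
qed

lemma nonmultiple_prod_translate:
  assumes "p dvd c"
  shows "nonmultiple_prod p (c + a) (c + b) = (\<Prod>i\<in>nonmultiples p a b. c + i)"
  unfolding nonmultiple_prod_def
proof (rule prod.reindex_bij_witness[of _ "\<lambda>i. c + i" "\<lambda>i. i - c"])
  show "i - c \<in> nonmultiples p a b" if "i \<in> nonmultiples p (c + a) (c + b)" for i
    using that assms by (auto simp: nonmultiples_def dvd_diff_left_iff)
qed (use assms in \<open>auto simp: nonmultiples_def dvd_add_right_iff\<close>)

lemma nonmultiple_prod_translate_cong:
  assumes "p dvd c" "m dvd c"
  shows "[nonmultiple_prod p (c + a) (c + b) = nonmultiple_prod p a b] (mod m)"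
proof -
  have "[(\<Prod>i\<in>nonmultiples p a b. c + i) = \<Prod>(nonmultiples p a b)] (mod m)"
    by (rule cong_prod) (use assms(2) in \<open>simp add: cong_iff_dvd_diff\<close>)
  thus ?thesis using nonmultiple_prod_translate[OF assms(1)] by (simp add: nonmultiple_prod_def)
qed

lemma nonmultiple_prod_reflect_cong:
  assumes "p dvd c" "m dvd c"
  shows "[nonmultiple_prod p (c - 1 - k) (c - 1) =
          (-1) ^ card (nonmultiples p 0 k) * nonmultiple_prod p 0 k] (mod m)"
proof -
  have "nonmultiple_prod p (c - 1 - k) (c - 1) = (\<Prod>i\<in>nonmultiples p 0 k. c - i)"
    unfolding nonmultiple_prod_def
    by (rule prod.reindex_bij_witness[of _ "\<lambda>i. c - i" "\<lambda>i. c - i"])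
      (use assms(1) in \<open>auto simp: nonmultiples_def dvd_diff_right_iff\<close>)
  also have "[\<dots> = (\<Prod>i\<in>nonmultiples p 0 k. - 1 * i)] (mod m)"
    by (rule cong_prod) (use assms(2) in \<open>simp add: cong_iff_dvd_diff\<close>)
  also have "(\<Prod>i\<in>nonmultiples p 0 k. - 1 * i) =
      (-1) ^ card (nonmultiples p 0 k) * nonmultiple_prod p 0 k"
    by (simp only: prod.distrib prod_constant nonmultiple_prod_def)
  finally show ?thesis .
qed

lemma nonmultiple_prod_periodic_cong:
  assumes "0 \<le> L" "p dvd L" "m dvd L"
  shows "[nonmultiple_prod p x (x + L) = nonmultiple_prod p 0 L] (mod m)"
proof (cases "L = 0")
  case False
  define g where "g i = (if \<not> p dvd i then i else 1)" for i
  have g_mod: "[g i = g (i mod L)] (mod m)" for i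
  proof -
    have "[i = i mod L] (mod m)" using assms(3) by (rule cong_dvd_modulus[rotated]) simp
    moreover have "p dvd i mod L \<longleftrightarrow> p dvd i" using assms(2) by (rule dvd_mod_iff)
    ultimately show ?thesis by (simp add: g_def)
  qed
  have "[nonmultiple_prod p a (a + L) = (\<Prod>i\<in>{0..<L}. g i)] (mod m)" for a
  proof -
    have "nonmultiple_prod p a (a + L) = (\<Prod>i\<in>{a<..a + L}. g i)"
      unfolding nonmultiple_prod_def nonmultiples_def g_def
      by (subst prod.inter_filter) simp_all
    also have "[\<dots> = (\<Prod>i\<in>{a<..a + L}. g (i mod L))] (mod m)" by (intro cong_prod g_mod)
    also have "(\<Prod>i\<in>{a<..a + L}. g (i mod L)) = (\<Prod>i\<in>{0..<L}. g i)"
      using prod.reindex_bij_betw[OF bij_betw_mult_mod[of L 1 a], of g] False assms(1) by simp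
    finally show ?thesis .
  qed
  from this[of x] this[of 0] show ?thesis by (auto simp: cong_def)
qed simp

section \<open>Shifted products of non-multiples\<close>

lemma prod_one_plus_cong:
  fixes c :: "'a :: unique_euclidean_ring"
  assumes "finite I"
  shows "[(\<Prod>i\<in>I. 1 + c * f i) = 1 + c * sum f I] (mod c ^ 2)"
  using assms
proof (induction I)
  case (insert j I)
  have "[(1 + c * f j) * (\<Prod>i\<in>I. 1 + c * f i) = (1 + c * f j) * (1 + c * sum f I)] (mod c ^ 2)"
    using insert.IH by (rule cong_scalar_left)
  also have "(1 + c * f j) * (1 + c * sum f I) = 1 + c * (f j + sum f I) + c ^ 2 * (f j * sum f I)"
    by (simp add: algebra_simps power2_eq_square)
  also have "[\<dots> = 1 + c * (f j + sum f I)] (mod c ^ 2)" by (simp add: cong_iff_dvd_diff)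
  finally show ?case using insert by simp
qed auto

lemma prod_add_cong:
  fixes c m :: "'a :: unique_euclidean_ring"
  assumes "finite I" "m dvd c"
    and inverse: "\<And>i. i \<in> I \<Longrightarrow> [d i * e i = 1] (mod m)" and sum: "m dvd sum e I"
  shows "[(\<Prod>i\<in>I. c + d i) = prod d I] (mod c * m)"
proof -
  have "[c + d i = d i * (1 + c * e i)] (mod c * m)" if "i \<in> I" for i
  proof -
    have "[c * 1 = c * (d i * e i)] (mod c * m)"
      using cong_sym[OF inverse[OF that]] by (rule cong_cmult_leftI)
    thus ?thesis by (simp add: cong_iff_dvd_diff algebra_simps)
  qed
  hence "[(\<Prod>i\<in>I. c + d i) = (\<Prod>i\<in>I. d i * (1 + c * e i))] (mod c * m)" by (rule cong_prod)
  also have "(\<Prod>i\<in>I. d i * (1 + c * e i)) = prod d I * (\<Prod>i\<in>I. 1 + c * e i)"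
    by (rule prod.distrib)
  also have "[\<dots> = prod d I * (1 + c * sum e I)] (mod c * m)"
    using cong_dvd_modulus[OF prod_one_plus_cong[OF assms(1)], of "c * m"] assms(2)
    by (intro cong_scalar_left) (simp add: power2_eq_square)
  also have "[prod d I * (1 + c * sum e I) = prod d I * (1 + 0)] (mod c * m)"
    using sum by (intro cong_scalar_left cong_add) (simp_all add: cong_0_iff)
  finally show ?thesis by simp
qed

lemma cong_of_cong_squares:
  fixes x y :: "'a :: {unique_euclidean_ring, euclidean_ring_gcd}"
  assumes "[x ^ 2 = y ^ 2] (mod p ^ e)" "[x = y] (mod p)" "coprime (2 * y) p"
  shows "[x = y] (mod p ^ e)"
proof -
  have "[2 * y = x + y] (mod p)" using cong_add[OF cong_sym[OF assms(2)] cong_refl[of y]] by simp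
  hence "coprime (x + y) p" using assms(3) by (rule cong_imp_coprime)
  hence "coprime (p ^ e) (x + y)" by (simp add: coprime_commute)
  moreover have "p ^ e dvd (x - y) * (x + y)"
    using assms(1) by (simp add: cong_iff_dvd_diff algebra_simps power2_eq_square)
  ultimately show ?thesis by (simp add: coprime_dvd_mult_left_iff cong_iff_dvd_diff)
qed

lemma prod_nonmultiples_shift_square:
  assumes "p dvd b"
  shows "(\<Prod>i\<in>nonmultiples p 0 b. a + i) ^ 2 =
         (\<Prod>i\<in>nonmultiples p 0 b. a * (a + b) + i * (b - i))"
proof -
  let ?I = "nonmultiples p 0 b"
  have neq: "i \<noteq> b" if "i \<in> ?I" for i using that assms by (auto simp: nonmultiples_def)
  have "(\<Prod>i\<in>?I. a + i) = (\<Prod>i\<in>?I. a + (b - i))"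
    by (rule prod.reindex_bij_witness[of _ "\<lambda>i. b - i" "\<lambda>i. b - i"])
      (use assms neq in \<open>auto simp: nonmultiples_def dvd_diff_right_iff order_less_le\<close>)
  hence "(\<Prod>i\<in>?I. a + i) ^ 2 = (\<Prod>i\<in>?I. (a + i) * (a + (b - i)))"
    by (simp add: power2_eq_square prod.distrib)
  also have "\<dots> = (\<Prod>i\<in>?I. a * (a + b) + i * (b - i))"
    by (intro prod.cong) (auto simp: algebra_simps)
  finally show ?thesis .
qed

text \<open>Pairing the factors \<open>a + i\<close> and \<open>a + (b - i)\<close> gives \<open>a (a + b) + i (b - i)\<close>, and the inverses
  of \<open>i (b - i) \<equiv> - i\<^sup>2\<close> sum to 0.\<close>

lemma nonmultiple_prod_shift_cong:
  assumes p: "prime p" "5 \<le> p" and dvd: "p dvd a" "p dvd b" "p ^ s dvd a" "p ^ s dvd b"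
    and dvd_prod: "p ^ t dvd a * (a + b) * p ^ s"
  shows "[nonmultiple_prod p a (a + b) = nonmultiple_prod p 0 b] (mod p ^ t)"
proof (rule cong_of_cong_squares)
  let ?I = "nonmultiples p 0 b"
  have "[(\<Prod>i\<in>?I. a * (a + b) + i * (b - i)) = (\<Prod>i\<in>?I. i * (b - i))]
      (mod a * (a + b) * p ^ s)"
  proof (rule prod_add_cong[where e = "\<lambda>i. - inv_square p s i"])
    show "[i * (b - i) * - inv_square p s i = 1] (mod p ^ s)" if "i \<in> ?I" for i
    proof -
      have "\<not> p dvd i" using that by (simp add: nonmultiples_def)
      have "[i * (b - i) * - inv_square p s i = i * (0 - i) * - inv_square p s i] (mod p ^ s)"
        using dvd(4)
        by (intro cong_scalar_right cong_scalar_left cong_diff) (simp_all add: cong_0_iff)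
      also have "i * (0 - i) * - inv_square p s i = i ^ 2 * inv_square p s i"
        by (simp add: power2_eq_square)
      also have "[i ^ 2 * inv_square p s i = 1] (mod p ^ s)"
        by (rule inv_square_inverse[OF p(1) \<open>\<not> p dvd i\<close>])
      finally show ?thesis .
    qed
    show "p ^ s dvd (\<Sum>i\<in>?I. - inv_square p s i)"
      using inv_square_sum_nonmultiples[OF p, of s 0 b] dvd(4) by (simp add: sum_negf)
  qed (use dvd(3) in simp_all)
  hence "[(\<Prod>i\<in>?I. a + i) ^ 2 = (\<Prod>i\<in>?I. 0 + i) ^ 2] (mod a * (a + b) * p ^ s)"
    unfolding prod_nonmultiples_shift_square[OF dvd(2)] by simp
  thus "[nonmultiple_prod p a (a + b) ^ 2 = nonmultiple_prod p 0 b ^ 2] (mod p ^ t)"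
    using nonmultiple_prod_translate[OF dvd(1), of 0 b] cong_dvd_modulus[OF _ dvd_prod]
    by (simp add: nonmultiple_prod_def)
  show "[nonmultiple_prod p a (a + b) = nonmultiple_prod p 0 b] (mod p)"
    using nonmultiple_prod_translate_cong[OF dvd(1) dvd(1), of 0 b] by simp
  have "odd p" using p by (intro prime_odd_int) auto
  thus "coprime (2 * nonmultiple_prod p 0 b) p"
    using coprime_nonmultiple_prod[OF p(1)] by simp
qed

lemma nonmultiple_prod_shift_cong_multiplicity:
  assumes p: "prime p" "5 \<le> p" and dvd: "p dvd a" "p dvd b" "p ^ multiplicity p b dvd a" and "b \<noteq> 0"
    and dvd_prod: "p ^ t dvd a * b * (a + b)"
  shows "[nonmultiple_prod p a (a + b) = nonmultiple_prod p 0 b] (mod p ^ t)"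
proof -
  let ?s = "multiplicity p b"
  have "\<not> is_unit p" using p(1) not_prime_unit by blast
  then obtain c where b_eq: "b = p ^ ?s * c" "\<not> p dvd c"
    by (rule multiplicity_decompose'[OF \<open>b \<noteq> 0\<close>])
  have "a * b * (a + b) = a * (a + b) * p ^ ?s * c" by (subst (1) b_eq(1)) (simp add: ac_simps)
  with dvd_prod have "p ^ t dvd a * (a + b) * p ^ ?s"
    using prime_imp_power_coprime[OF p(1) b_eq(2)]
    by (simp add: coprime_dvd_mult_left_iff coprime_commute)
  with dvd show ?thesis by (intro nonmultiple_prod_shift_cong[OF p]) (auto intro: multiplicity_dvd)
qed

text \<open>By symmetry in \<open>a\<close> and \<open>b\<close>, the preceding condition on multiplicities is no restriction.\<close>

lemma nonmultiple_prod_add_cong_nonneg: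
  assumes p: "prime p" "5 \<le> p" and dvd: "p dvd a" "p dvd b" and nonneg: "0 \<le> a" "0 \<le> b"
    and dvd_prod: "p ^ t dvd a * b * (a + b)"
  shows "[nonmultiple_prod p 0 (a + b) = nonmultiple_prod p 0 a * nonmultiple_prod p 0 b]
         (mod p ^ t)"
proof -
  have shift:
    "[nonmultiple_prod p 0 (x + y) = nonmultiple_prod p 0 x * nonmultiple_prod p 0 y] (mod p ^ t)"
    if "p dvd x" "p dvd y" "0 \<le> x" "0 < y" "p ^ multiplicity p y dvd x"
      and "p ^ t dvd x * y * (x + y)" for x y
  proof -
    have "[nonmultiple_prod p x (x + y) = nonmultiple_prod p 0 y] (mod p ^ t)"
      using that by (intro nonmultiple_prod_shift_cong_multiplicity[OF p]) simp_all
    hence "[nonmultiple_prod p 0 x * nonmultiple_prod p x (x + y) =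
        nonmultiple_prod p 0 x * nonmultiple_prod p 0 y] (mod p ^ t)"
      by (rule cong_scalar_left)
    thus ?thesis using that(3,4) by (simp add: nonmultiple_prod_concat)
  qed
  consider (zero) "a = 0 \<or> b = 0" | (le) "0 < a" "0 < b" "multiplicity p b \<le> multiplicity p a"
    | (ge) "0 < a" "0 < b" "multiplicity p a \<le> multiplicity p b"
    using nonneg by linarith
  thus ?thesis
  proof cases
    case le
    thus ?thesis using shift[of a b] dvd dvd_prod by (simp add: multiplicity_dvd')
  next
    case ge
    thus ?thesis using shift[of b a] dvd dvd_prod by (simp add: multiplicity_dvd' ac_simps)
  qed auto
qed

lemma nonmultiple_prod_add_cong:
  assumes p: "prime p" "5 \<le> p" and dvd: "p dvd a" "p dvd b" and "0 \<le> b"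
    and dvd_prod: "p ^ t dvd a * b * (a + b)"
  shows "[nonmultiple_prod p a (a + b) = nonmultiple_prod p 0 b] (mod p ^ t)"
proof (cases "t = 0")
  case False
  define a' where "a' = a mod p ^ t"
  have "0 \<le> a'" using p(2) by (simp add: a'_def)
  have a_eq: "a = p ^ t * (a div p ^ t) + a'" by (simp add: a'_def)
  have "p dvd p ^ t" using False by simp
  hence dvd': "p dvd a'" using dvd(1) by (simp add: a'_def dvd_mod_iff)
  have "[a * b * (a + b) = a' * b * (a' + b)] (mod p ^ t)"
    by (intro cong_mult cong_add) (simp_all add: a'_def)
  hence "p ^ t dvd a' * b * (a' + b)" using dvd_prod cong_dvd_iff by blast
  hence "[nonmultiple_prod p 0 (a' + b) = nonmultiple_prod p 0 a' * nonmultiple_prod p 0 b]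
      (mod p ^ t)"
    using dvd dvd' \<open>0 \<le> a'\<close> assms(5) by (intro nonmultiple_prod_add_cong_nonneg[OF p])
  moreover have
    "nonmultiple_prod p 0 (a' + b) = nonmultiple_prod p 0 a' * nonmultiple_prod p a' (a' + b)"
    using \<open>0 \<le> a'\<close> assms(5) by (simp add: nonmultiple_prod_concat)
  ultimately have "[nonmultiple_prod p a' (a' + b) = nonmultiple_prod p 0 b] (mod p ^ t)"
    using coprime_nonmultiple_prod[OF p(1)] by (simp add: cong_mult_lcancel)
  moreover have "[nonmultiple_prod p a (a + b) = nonmultiple_prod p a' (a' + b)] (mod p ^ t)"
    using nonmultiple_prod_translate_cong[of p "p ^ t * (a div p ^ t)" "p ^ t" a' "a' + b"]
      \<open>p dvd p ^ t\<close>
    by (simp add: a_eq[symmetric] add.assoc[symmetric])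
  ultimately show ?thesis by (rule cong_trans[rotated])
qed simp

lemma nonmultiple_prod_mult_cong:
  assumes p: "prime p" "5 \<le> p" and "0 \<le> b" and dvd_prod: "p ^ t dvd a * b * (a + b)"
  shows "[nonmultiple_prod p (p * a) (p * (a + b)) = nonmultiple_prod p 0 (p * b)]
         (mod p ^ (t + 3))"
proof -
  have "p ^ 3 * p ^ t dvd p ^ 3 * (a * b * (a + b))"
    using dvd_prod by (rule mult_dvd_mono[OF dvd_refl])
  also have "p ^ 3 * (a * b * (a + b)) = p * a * (p * b) * (p * a + p * b)"
    by (simp add: power3_eq_cube algebra_simps)
  finally have "p ^ (t + 3) dvd p * a * (p * b) * (p * a + p * b)"
    by (simp add: power_add mult.commute)
  moreover have "0 \<le> p * b" using p(2) assms(3) by simp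
  ultimately have "[nonmultiple_prod p (p * a) (p * a + p * b) = nonmultiple_prod p 0 (p * b)]
      (mod p ^ (t + 3))"
    by (intro nonmultiple_prod_add_cong[OF p]) simp_all
  thus ?thesis by (simp only: distrib_left)
qed

section \<open>Integer binomial coefficients\<close>

lemma of_int_ibinom: "rat_of_int (ibinom n (int k)) = rat_of_int n gchoose k"
  unfolding ibinom_def by (simp add: of_int_gbinomial[symmetric])

lemma ibinom_of_nat: "ibinom (int n) (int k) = int (n choose k)"
proof -
  have "rat_of_int (ibinom (int n) (int k)) = rat_of_int (int (n choose k))"
    by (simp add: of_int_ibinom binomial_gbinomial)
  thus ?thesis by (simp only: of_int_eq_iff)
qed

lemma ibinom_symmetric: "ibinom n (n - k) = ibinom n k"
proof (cases "0 \<le> k \<and> 0 \<le> n - k")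
  case True
  define x y where "x = nat k" and "y = nat (n - k)"
  have k_eq: "k = int x" and n_eq: "n = int (x + y)" and "n - k = int y"
    using True by (auto simp: x_def y_def)
  hence "ibinom n (n - k) = int ((x + y) choose y)" by (simp only: ibinom_of_nat)
  also have "\<dots> = int ((x + y) choose x)" using binomial_symmetric[of x "x + y"] by simp
  also have "\<dots> = ibinom n k" unfolding k_eq n_eq by (simp only: ibinom_of_nat)
  finally show ?thesis .
qed (auto simp: ibinom_def)

lemma ibinom_eq_0:
  assumes "k < 0 \<and> n < k \<or> 0 \<le> n \<and> (k < 0 \<or> n < k)"
  shows "ibinom n k = 0"
proof (cases "0 \<le> n")
  case True
  have "ibinom n l = 0" if "n < l" for l
  proof -
    have "ibinom (int (nat n)) (int (nat l)) = 0"
      using True that by (subst ibinom_of_nat) auto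
    thus ?thesis using True that by simp
  qed
  from this[of k] this[of "n - k"] show ?thesis using True assms ibinom_symmetric[of n k] by auto
qed (use assms in \<open>auto simp: ibinom_def\<close>)

lemma ibinom_absorption:
  assumes "k \<noteq> 0"
  shows "k * ibinom n k = n * ibinom (n - 1) (k - 1)"
proof -
  consider (pos) "0 < k" | (neg) "k < 0" "0 \<le> n - k" | (zero) "k < 0" "n - k < 0"
    using assms by linarith
  thus ?thesis
  proof cases
    case pos
    define j where "j = nat (k - 1)"
    have j: "k = int (Suc j)" "k - 1 = int j" using pos by (auto simp: j_def)
    have "rat_of_int (int (Suc j) * ibinom n (int (Suc j))) =
        rat_of_int (n * ibinom (n - 1) (int j))"
      using gbinomial_absorption[of j "rat_of_int n"] by (simp add: of_int_ibinom del: of_nat_Suc)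
    thus ?thesis unfolding j(2) unfolding j(1) by (simp only: of_int_eq_iff)
  next
    case neg
    then obtain j where j: "n - k = int j" using nonneg_int_cases by blast
    have "rat_of_int ((n - int j) * ibinom n (int j)) = rat_of_int (n * ibinom (n - 1) (int j))"
      using gbinomial_absorb_comp[of "rat_of_int n" j] by (simp add: of_int_ibinom)
    hence "(n - int j) * ibinom n (int j) = n * ibinom (n - 1) (int j)"
      by (simp only: of_int_eq_iff)
    moreover have "n - int j = k" "int j = (n - 1) - (k - 1)" using j by simp_all
    ultimately show ?thesis
      using ibinom_symmetric[of n k] ibinom_symmetric[of "n - 1" "k - 1"] by simp
  next
    case zero
    thus ?thesis by (simp add: ibinom_eq_0)
  qed
qed

lemma dvd_gcd_mult_ibinom:
  assumes "m dvd n"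
  shows "m dvd gcd m k * ibinom n k"
proof (cases "k = 0")
  case False
  have "m dvd k * ibinom n k" unfolding ibinom_absorption[OF False] using assms by simp
  moreover have "m dvd m * ibinom n k" by simp
  ultimately have "m dvd gcd (ibinom n k * m) (ibinom n k * k)" by (simp add: mult.commute)
  hence "m dvd \<bar>ibinom n k\<bar> * gcd m k" by (simp only: gcd_mult_distrib_int)
  thus ?thesis by (simp add: abs_if mult.commute split: if_splits)
qed simp

lemma fact_mult_ibinom: "fact k * ibinom n (int k) = \<Prod>{n - int k<..n}"
proof -
  have "rat_of_int (fact k * ibinom n (int k)) = rat_of_int (\<Prod>i\<in>{0..<k}. n - int i)"
    using gbinomial_mult_fact[of k "rat_of_int n"] by (simp add: of_int_ibinom)
  hence "fact k * ibinom n (int k) = (\<Prod>i\<in>{0..<k}. n - int i)" by (simp only: of_int_eq_iff)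
  also have "\<dots> = \<Prod>{n - int k<..n}"
    by (rule prod.reindex_bij_witness[of _ "\<lambda>i. nat (n - i)" "\<lambda>i. n - int i"]) auto
  finally show ?thesis .
qed

lemma ibinom_mult_prod:
  assumes "0 \<le> k"
  shows "ibinom n k * \<Prod>{0<..k} = \<Prod>{n - k<..n}"
proof -
  obtain j where j: "k = int j" using assms nonneg_int_cases by blast
  have "fact j = \<Prod>{0<..int j}"
    using fact_mult_ibinom[of j "int j"] by (simp add: ibinom_of_nat)
  thus ?thesis using fact_mult_ibinom[of j n] by (simp add: j mult.commute)
qed

section \<open>Ratios of binomial coefficients\<close>

text \<open>The hypothesis on the quotients says that the addition \<open>(n - k) + k\<close> in base \<open>p\<close> does not
  carry out of the last digit.\<close>

lemma ibinom_mult_nonmultiple_prod: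
  assumes "0 < p" "0 \<le> k" and no_carry: "(n - k) div p = n div p - k div p"
  shows "ibinom n k * nonmultiple_prod p 0 k =
         ibinom (n div p) (k div p) * nonmultiple_prod p (n - k) n"
proof -
  let ?c = "p ^ nat (k div p) * \<Prod>{0<..k div p}"
  have "0 \<le> k div p" using assms by (simp add: pos_imp_zdiv_nonneg_iff)
  have "?c * (ibinom n k * nonmultiple_prod p 0 k) = \<Prod>{n - k<..n}"
    using ibinom_mult_prod[OF assms(2), of n]
      prod_greaterThanAtMost_split_multiples[OF assms(1), of 0 k]
    by (simp add: ac_simps)
  also have "\<dots> = p ^ nat (k div p) * \<Prod>{n div p - k div p<..n div p} * nonmultiple_prod p (n - k) n"
    unfolding prod_greaterThanAtMost_split_multiples[OF assms(1), of "n - k" n] no_carry by simp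
  also have "\<dots> = ?c * (ibinom (n div p) (k div p) * nonmultiple_prod p (n - k) n)"
    by (simp add: ibinom_mult_prod[OF \<open>0 \<le> k div p\<close>, symmetric] ac_simps)
  finally show ?thesis using assms(1) by simp
qed

lemma ibinom_div_ratio_cong_nonneg:
  assumes p: "prime p" and "0 \<le> k" and no_carry: "(n - k) div p = n div p - k div p"
    and "coprime c p"
    and cong: "[nonmultiple_prod p (n - k) n = c * nonmultiple_prod p 0 k] (mod p ^ e)"
  shows "ratio_cong_1 p e (ibinom n k) (c * ibinom (n div p) (k div p))"
  unfolding ratio_cong_1_def
proof (intro exI conjI)
  show "coprime (c * nonmultiple_prod p 0 k) p"
    using coprime_nonmultiple_prod[OF p] assms(4) by simp
  show "[c * nonmultiple_prod p 0 k = nonmultiple_prod p (n - k) n] (mod p ^ e)"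
    using cong by (rule cong_sym)
  show "ibinom n k * (c * nonmultiple_prod p 0 k) =
      c * ibinom (n div p) (k div p) * nonmultiple_prod p (n - k) n"
    using ibinom_mult_nonmultiple_prod[OF prime_gt_0_int[OF p] assms(2) no_carry]
    by (simp add: ac_simps)
qed

lemma ibinom_div_ratio_cong:
  assumes p: "prime p" and no_carry: "(n - k) div p = n div p - k div p" and "coprime c p"
    and "0 \<le> k \<Longrightarrow> [nonmultiple_prod p (n - k) n = c * nonmultiple_prod p 0 k] (mod p ^ e)"
    and "0 \<le> n - k \<Longrightarrow> [nonmultiple_prod p k n = c * nonmultiple_prod p 0 (n - k)] (mod p ^ e)"
  shows "ratio_cong_1 p e (ibinom n k) (c * ibinom (n div p) (k div p))"
proof -
  consider (lower) "0 \<le> k" | (upper) "0 \<le> n - k" | (zero) "k < 0" "n - k < 0" by linarith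
  thus ?thesis
  proof cases
    case lower
    thus ?thesis using assms by (intro ibinom_div_ratio_cong_nonneg)
  next
    case upper
    have "ratio_cong_1 p e (ibinom n (n - k)) (c * ibinom (n div p) ((n - k) div p))"
      using upper assms by (intro ibinom_div_ratio_cong_nonneg) simp_all
    thus ?thesis by (simp only: no_carry ibinom_symmetric)
  next
    case zero
    have "k div p < 0" "(n - k) div p < 0"
      using zero pos_imp_zdiv_neg_iff[OF prime_gt_0_int[OF p]] by blast+
    hence "ibinom n k = 0" "ibinom (n div p) (k div p) = 0"
      using zero no_carry by (auto intro!: ibinom_eq_0)
    thus ?thesis unfolding ratio_cong_1_def by (auto intro!: exI[of _ 1])
  qed
qed

lemma jacobsthal_kazandzidis:
  assumes p: "prime p" "5 \<le> p" and dvd_prod: "p ^ t dvd n * k * (n - k)"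
  shows "ratio_cong_1 p (t + 3) (ibinom (p * n) (p * k)) (ibinom n k)"
proof -
  have "0 < p" using p(2) by simp
  have "ratio_cong_1 p (t + 3) (ibinom (p * n) (p * k)) (1 * ibinom (p * n div p) (p * k div p))"
  proof (rule ibinom_div_ratio_cong[OF p(1)])
    show "(p * n - p * k) div p = p * n div p - p * k div p"
      using \<open>0 < p\<close> by (simp flip: right_diff_distrib)
    show "[nonmultiple_prod p (p * n - p * k) (p * n) = 1 * nonmultiple_prod p 0 (p * k)]
        (mod p ^ (t + 3))" if "0 \<le> p * k"
      using nonmultiple_prod_mult_cong[OF p, of k t "n - k"] that \<open>0 < p\<close> dvd_prod
      by (simp add: zero_le_mult_iff right_diff_distrib mult_ac)
    show "[nonmultiple_prod p (p * k) (p * n) = 1 * nonmultiple_prod p 0 (p * n - p * k)]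
        (mod p ^ (t + 3))" if "0 \<le> p * n - p * k"
      using nonmultiple_prod_mult_cong[OF p, of "n - k" t k] that \<open>0 < p\<close> dvd_prod
      by (simp add: right_diff_distrib mult_ac)
  qed simp
  thus ?thesis using \<open>0 < p\<close> by simp
qed

lemma ibinom_pred_ratio_cong:
  assumes p: "prime p" "odd p" and dvd: "p ^ q dvd m"
  shows "ratio_cong_1 p (Suc q) (ibinom (p * m - 1) k)
           ((-1) ^ nat \<bar>k - k div p\<bar> * ibinom (m - 1) (k div p))"
proof -
  have "0 < p" by (rule prime_gt_0_int[OF p(1)])
  have reflect: "[nonmultiple_prod p (p * m - 1 - i) (p * m - 1) =
      (-1) ^ nat \<bar>i - i div p\<bar> * nonmultiple_prod p 0 i] (mod p ^ Suc q)" if "0 \<le> i" for i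
  proof -
    have "card (nonmultiples p 0 i) = nat \<bar>i - i div p\<bar>"
      using card_nonmultiples[OF \<open>0 < p\<close> that] by linarith
    moreover have "p ^ Suc q dvd p * m" using dvd by simp
    ultimately show ?thesis using nonmultiple_prod_reflect_cong[of p "p * m" "p ^ Suc q" i] by simp
  qed
  let ?i = "p * m - 1 - k"
  have div_i: "?i div p = m - 1 - k div p" by (rule mult_minus_one_minus_div[OF \<open>0 < p\<close>])
  have div_pred: "(p * m - 1) div p = m - 1"
    using mult_minus_one_minus_div[OF \<open>0 < p\<close>, of m 0] by simp
  have "even (?i - ?i div p) \<longleftrightarrow> even (k - k div p)" unfolding div_i using p(2) by auto
  hence sign: "(-1 :: int) ^ nat \<bar>?i - ?i div p\<bar> = (-1) ^ nat \<bar>k - k div p\<bar>"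
    by (simp add: minus_one_power_iff even_nat_iff)
  have "ratio_cong_1 p (Suc q) (ibinom (p * m - 1) k)
      ((-1) ^ nat \<bar>k - k div p\<bar> * ibinom ((p * m - 1) div p) (k div p))"
  proof (rule ibinom_div_ratio_cong[OF p(1)])
    show "[nonmultiple_prod p k (p * m - 1) =
        (-1) ^ nat \<bar>k - k div p\<bar> * nonmultiple_prod p 0 ?i] (mod p ^ Suc q)" if "0 \<le> ?i"
      using reflect[OF that] unfolding sign by simp
  qed (use reflect div_i div_pred in simp_all)
  thus ?thesis unfolding div_pred .
qed

lemma ibinom_div_mult_ratio_cong:
  assumes p: "prime p" and dvd: "p ^ q dvd m"
  shows "ratio_cong_1 p (Suc q) (ibinom n (p * m)) (ibinom (n div p) m)"
proof -
  have "0 < p" by (rule prime_gt_0_int[OF p])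
  have dvd': "p ^ Suc q dvd p * m" using dvd by simp
  have "ratio_cong_1 p (Suc q) (ibinom n (p * m)) (1 * ibinom (n div p) (p * m div p))"
  proof (rule ibinom_div_ratio_cong[OF p])
    show "(n - p * m) div p = n div p - p * m div p"
      using div_mult_self2[of p n "- m"] \<open>0 < p\<close> by simp
    show "[nonmultiple_prod p (n - p * m) n = 1 * nonmultiple_prod p 0 (p * m)] (mod p ^ Suc q)"
      if "0 \<le> p * m"
      using nonmultiple_prod_periodic_cong[OF that _ dvd', of p "n - p * m"] by simp
    show "[nonmultiple_prod p (p * m) n = 1 * nonmultiple_prod p 0 (n - p * m)] (mod p ^ Suc q)"
      using nonmultiple_prod_translate_cong[OF _ dvd', of p 0 "n - p * m"] by simp
  qed simp
  thus ?thesis using \<open>0 < p\<close> by simp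
qed

section \<open>Descent along base-\<open>p\<close> blocks\<close>

text \<open>Each step replaces \<open>C (Suc s)\<close> by \<open>C s\<close> and absorbs the inner sums over a block
  into the weight, whose divisibility by \<open>p\<close> makes up for the weaker modulus at the next level.\<close>

lemma dvd_sum_of_dvd_block_sums:
  fixes p a b :: int
  assumes "0 < p"
    and C_cong: "\<And>s i. [C (Suc s) i = C s (i div p)] (mod p ^ Suc s)"
    and block_sums: "\<And>s j. s \<le> r \<Longrightarrow> p ^ (s + t) dvd (\<Sum>k\<in>{p ^ s * (j - 1)<..p ^ s * j}. w k)"
  shows "p ^ (r + t) dvd (\<Sum>k\<in>{p ^ r * a<..p ^ r * b}. C r (k - 1) * w k)"
  using block_sums
proof (induction r arbitrary: t w)
  case 0
  have "p ^ t dvd w k" for k using "0.prems"[of 0 k] by (simp add: greaterThanAtMost_pred_self)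
  thus ?case by (auto intro!: dvd_sum)
next
  case (Suc r)
  define w' where "w' j = (\<Sum>k\<in>{p * (j - 1)<..p * j}. w k)" for j
  let ?S = "\<Sum>k\<in>{p ^ Suc r * a<..p ^ Suc r * b}. C (Suc r) (k - 1) * w k"
  let ?S' = "\<Sum>j\<in>{p ^ r * a<..p ^ r * b}. C r (j - 1) * w' j"
  have w_dvd: "p ^ t dvd w k" for k
    using Suc.prems[of 0 k] by (simp add: greaterThanAtMost_pred_self)
  have IH: "p ^ (r + Suc t) dvd ?S'"
  proof (rule Suc.IH)
    fix s j assume "s \<le> r"
    have "(\<Sum>k\<in>{p ^ Suc s * (j - 1)<..p ^ Suc s * j}. w k) =
        (\<Sum>i\<in>{p ^ s * (j - 1)<..p ^ s * j}. w' i)"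
      unfolding w'_def power_Suc mult.assoc by (rule sum_blocks[OF assms(1)])
    thus "p ^ (s + Suc t) dvd (\<Sum>i\<in>{p ^ s * (j - 1)<..p ^ s * j}. w' i)"
      using Suc.prems[of "Suc s" j] \<open>s \<le> r\<close> by simp
  qed
  have weighted_cong: "[C (Suc r) i * w k = C r (i div p) * w k] (mod p ^ (Suc r + t))" for i k
    unfolding power_add by (rule cong_mult_of_dvd[OF C_cong w_dvd])
  have "[?S = (\<Sum>k\<in>{p ^ Suc r * a<..p ^ Suc r * b}. C r ((k - 1) div p) * w k)]
      (mod p ^ (Suc r + t))"
    by (intro cong_sum weighted_cong)
  also have "(\<Sum>k\<in>{p ^ Suc r * a<..p ^ Suc r * b}. C r ((k - 1) div p) * w k) =
      (\<Sum>j\<in>{p ^ r * a<..p ^ r * b}. \<Sum>k\<in>{p * (j - 1)<..p * j}. C r ((k - 1) div p) * w k)"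
    unfolding power_Suc mult.assoc by (rule sum_blocks[OF assms(1)])
  also have "\<dots> = ?S'"
    unfolding w'_def sum_distrib_left
    by (intro sum.cong refl) (simp only: pred_div_eq_pred_iff[OF assms(1), THEN iffD2])
  finally have "p ^ (Suc r + t) dvd ?S \<longleftrightarrow> p ^ (Suc r + t) dvd ?S'" by (rule cong_dvd_iff)
  thus ?case using IH by simp
qed

section \<open>The supercongruence\<close>

lemma A_term_support:
  assumes "A_term n1 n2 n3 n4 k \<noteq> 0"
  shows "\<bar>k\<bar> \<le> \<bar>n1\<bar> + \<bar>n2\<bar>"
proof -
  have "ibinom n1 k \<noteq> 0" "ibinom (n1 + n2 - k) n1 \<noteq> 0" using assms by (auto simp: A_term_def)
  hence "\<not> (0 \<le> n1 \<and> (k < 0 \<or> n1 < k))" "\<not> (n1 < 0 \<and> n1 + n2 - k < n1)"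
    "\<not> (0 \<le> n1 + n2 - k \<and> n1 < 0)" using ibinom_eq_0 by blast+
  thus ?thesis by linarith
qed

lemma A_eq_sum:
  assumes "\<bar>n1\<bar> + \<bar>n2\<bar> < X"
  shows "A n1 n2 n3 n4 = (\<Sum>k\<in>{- X<..X}. A_term n1 n2 n3 n4 k)"
  unfolding A_def
proof (rule sum.mono_neutral_left)
  show "{k. A_term n1 n2 n3 n4 k \<noteq> 0} \<subseteq> {- X<..X}"
    using A_term_support assms by fastforce
qed auto

lemma A_scaled_eq_sum:
  assumes "\<bar>n1\<bar> + \<bar>n2\<bar> < L" "0 < c"
  shows "A (c * n1) (c * n2) (c * n3) (c * n4) =
         (\<Sum>k\<in>{c * (- L)<..c * L}. A_term (c * n1) (c * n2) (c * n3) (c * n4) k)"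
proof -
  have "\<bar>c * n1\<bar> + \<bar>c * n2\<bar> < c * L"
    using assms by (simp add: abs_mult flip: distrib_left)
  thus ?thesis by (simp add: A_eq_sum)
qed

lemma prime_power_dvd_ibinom:
  assumes "prime p"
  obtains s where "s \<le> q" "p ^ s dvd k" "\<And>n. p ^ q dvd n \<Longrightarrow> p ^ (q - s) dvd ibinom n k"
proof -
  obtain s where "s \<le> q" "normalize (gcd (p ^ q) k) = p ^ s"
    by (rule divides_primepow[OF assms gcd_dvd1])
  hence s: "s \<le> q" "gcd (p ^ q) k = p ^ s" by simp_all
  have "p ^ s dvd k" unfolding s(2)[symmetric] by simp
  moreover have "p ^ (q - s) dvd ibinom n k" if "p ^ q dvd n" for n
  proof -
    have "p ^ s * p ^ (q - s) dvd p ^ s * ibinom n k"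
      using dvd_gcd_mult_ibinom[OF that, of k] s(1) unfolding s(2) by (simp flip: power_add)
    thus ?thesis using prime_gt_0_int[OF assms] by simp
  qed
  ultimately show ?thesis using s(1) that by blast
qed

lemma A_term_mult_cong:
  assumes p: "prime p" "5 \<le> p"
    and dvd: "p ^ q dvd n1" "p ^ q dvd n2" "p ^ q dvd n3" "p ^ q dvd n4"
  shows "[A_term (p * n1) (p * n2) (p * n3) (p * n4) (p * k) = A_term n1 n2 n3 n4 k]
         (mod p ^ (3 * Suc q))"
proof -
  obtain s where s: "s \<le> q" "p ^ s dvd k" "\<And>n. p ^ q dvd n \<Longrightarrow> p ^ (q - s) dvd ibinom n k"
    using prime_power_dvd_ibinom[OF p(1)] by blast
  have dvd_s: "p ^ s dvd n" if "p ^ q dvd n" for n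
    using that s(1) by (meson dvd_trans le_imp_power_dvd)
  let ?e = "q + s + s + 3"
  have upper: "ratio_cong_1 p ?e (ibinom (p * n) (p * k)) (ibinom n k)" if "p ^ q dvd n" for n
  proof (rule jacobsthal_kazandzidis[OF p])
    show "p ^ (q + s + s) dvd n * k * (n - k)"
      unfolding power_add using that dvd_s[OF that] s(2) by (intro mult_dvd_mono dvd_diff)
  qed
  have lower: "ratio_cong_1 p ?e (ibinom (p * n + p * m - p * k) (p * n)) (ibinom (n + m - k) n)"
    if "p ^ q dvd n" "p ^ q dvd m" for n m
  proof -
    have "p ^ s * p ^ q * p ^ s dvd (n + m - k) * n * (n + m - k - n)"
      using that(1) dvd_s[OF that(1)] dvd_s[OF that(2)] s(2)
      by (intro mult_dvd_mono dvd_diff dvd_add)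
    hence "p ^ (q + s + s) dvd (n + m - k) * n * (n + m - k - n)"
      by (simp only: power_add mult_ac)
    hence "ratio_cong_1 p ?e (ibinom (p * (n + m - k)) (p * n)) (ibinom (n + m - k) n)"
      by (rule jacobsthal_kazandzidis[OF p])
    thus ?thesis by (simp only: distrib_left right_diff_distrib)
  qed
  have "ratio_cong_1 p ?e (A_term (p * n1) (p * n2) (p * n3) (p * n4) (p * k))
      (A_term n1 n2 n3 n4 k)"
    unfolding A_term_def by (intro ratio_cong_1_mult upper lower dvd)
  moreover have "p ^ ((q - s) + (q - s)) dvd A_term n1 n2 n3 n4 k"
    unfolding A_term_def power_add
    by (rule dvd_mult2, rule dvd_mult2) (intro mult_dvd_mono s(3) dvd)
  ultimately have "[A_term (p * n1) (p * n2) (p * n3) (p * n4) (p * k) = A_term n1 n2 n3 n4 k]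
      (mod p ^ (?e + ((q - s) + (q - s))))"
    by (rule ratio_cong_1_imp_cong)
  moreover have "?e + ((q - s) + (q - s)) = 3 * Suc q" using s(1) by simp
  ultimately show ?thesis by (simp only:)
qed

definition absorbed_term :: "int \<Rightarrow> int \<Rightarrow> int \<Rightarrow> int \<Rightarrow> int \<Rightarrow> int" where
  "absorbed_term n1 n2 n3 n4 i =
     ibinom (n1 - 1) i * ibinom (n3 - 1) i *
     ibinom (n1 + n2 - 1 - i) n1 * ibinom (n3 + n4 - 1 - i) n3"

lemma A_term_absorption:
  assumes "k \<noteq> 0"
  shows "k ^ 2 * A_term n1 n2 n3 n4 k = n1 * n3 * absorbed_term n1 n2 n3 n4 (k - 1)"
proof -
  have "k ^ 2 * A_term n1 n2 n3 n4 k = (k * ibinom n1 k) * (k * ibinom n3 k) *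
      ibinom (n1 + n2 - k) n1 * ibinom (n3 + n4 - k) n3"
    by (simp add: A_term_def power2_eq_square)
  also have "\<dots> = (n1 * ibinom (n1 - 1) (k - 1)) * (n3 * ibinom (n3 - 1) (k - 1)) *
      ibinom (n1 + n2 - k) n1 * ibinom (n3 + n4 - k) n3"
    by (simp only: ibinom_absorption[OF assms])
  also have "\<dots> = n1 * n3 * absorbed_term n1 n2 n3 n4 (k - 1)"
    by (simp add: absorbed_term_def algebra_simps)
  finally show ?thesis .
qed

lemma absorbed_term_div_cong:
  assumes p: "prime p" "odd p"
    and dvd: "p ^ q dvd n1" "p ^ q dvd n2" "p ^ q dvd n3" "p ^ q dvd n4"
  shows "[absorbed_term (p * n1) (p * n2) (p * n3) (p * n4) i =
          absorbed_term n1 n2 n3 n4 (i div p)] (mod p ^ Suc q)"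
proof -
  let ?s = "(-1) ^ nat \<bar>i - i div p\<bar> :: int"
  note upper = ibinom_pred_ratio_cong[OF p]
  have lower: "ratio_cong_1 p (Suc q) (ibinom (p * n + p * m - 1 - i) (p * n))
      (ibinom (n + m - 1 - i div p) n)" if "p ^ q dvd n" for n m
    using ibinom_div_mult_ratio_cong[OF p(1) that, of "p * (n + m) - 1 - i"]
    unfolding mult_minus_one_minus_div[OF prime_gt_0_int[OF p(1)]] by (simp only: distrib_left)
  have "ratio_cong_1 p (Suc q) (absorbed_term (p * n1) (p * n2) (p * n3) (p * n4) i)
     ((?s * ibinom (n1 - 1) (i div p)) * (?s * ibinom (n3 - 1) (i div p)) *
       ibinom (n1 + n2 - 1 - i div p) n1 * ibinom (n3 + n4 - 1 - i div p) n3)"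
    unfolding absorbed_term_def by (intro ratio_cong_1_mult upper lower dvd)
  also have "(?s * ibinom (n1 - 1) (i div p)) * (?s * ibinom (n3 - 1) (i div p)) *
       ibinom (n1 + n2 - 1 - i div p) n1 * ibinom (n3 + n4 - 1 - i div p) n3 =
       ?s * ?s * absorbed_term n1 n2 n3 n4 (i div p)"
    by (simp only: absorbed_term_def mult_ac)
  also have "?s * ?s * absorbed_term n1 n2 n3 n4 (i div p) = absorbed_term n1 n2 n3 n4 (i div p)"
    by (simp only: minus_one_power_iff) simp
  finally show ?thesis using ratio_cong_1_imp_cong[of p "Suc q" _ _ 0] by simp
qed

lemma sum_absorbed_term_inv_square_dvd:
  assumes p: "prime p" "5 \<le> p"
  shows "p ^ r dvd (\<Sum>k\<in>{p ^ r * a<..p ^ r * b}.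
    absorbed_term (p ^ r * n1) (p ^ r * n2) (p ^ r * n3) (p ^ r * n4) (k - 1) * inv_square p r k)"
proof -
  define C where "C s = absorbed_term (p ^ s * n1) (p ^ s * n2) (p ^ s * n3) (p ^ s * n4)" for s
  have "p ^ (r + 0) dvd (\<Sum>k\<in>{p ^ r * a<..p ^ r * b}. C r (k - 1) * inv_square p r k)"
  proof (rule dvd_sum_of_dvd_block_sums)
    have "odd p" using p by (intro prime_odd_int) auto
    show "[C (Suc s) i = C s (i div p)] (mod p ^ Suc s)" for s i
      using absorbed_term_div_cong[OF p(1) \<open>odd p\<close>, of s "p ^ s * n1" "p ^ s * n2"
          "p ^ s * n3" "p ^ s * n4" i]
      by (simp add: C_def mult.assoc)
    show "p ^ (s + 0) dvd (\<Sum>k\<in>{p ^ s * (j - 1)<..p ^ s * j}. inv_square p r k)" if "s \<le> r" for s j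
      using inv_square_sum_block[OF p that, of "p ^ s * (j - 1)"] by (simp add: right_diff_distrib)
  qed (use p in simp)
  thus ?thesis by (simp add: C_def)
qed

lemma A_term_nonmultiple_cong:
  fixes r :: nat
  assumes "prime p" "\<not> p dvd k"
  defines "P \<equiv> p ^ r"
  shows "[A_term (P * n1) (P * n2) (P * n3) (P * n4) k =
          P ^ 2 * (n1 * n3) *
            (absorbed_term (P * n1) (P * n2) (P * n3) (P * n4) (k - 1) * inv_square p r k)]
         (mod P ^ 2 * P)"
proof -
  let ?T = "A_term (P * n1) (P * n2) (P * n3) (P * n4) k"
  let ?C = "absorbed_term (P * n1) (P * n2) (P * n3) (P * n4) (k - 1)"
  have "k \<noteq> 0" using assms(2) by auto
  hence absorb: "k ^ 2 * ?T = P ^ 2 * (n1 * n3 * ?C)"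
    using A_term_absorption[of k "P * n1" "P * n2" "P * n3" "P * n4"]
    by (simp add: power2_eq_square ac_simps)
  have "coprime (P ^ 2) (k ^ 2)"
    using prime_imp_power_coprime[OF assms(1,2)] by (simp add: P_def coprime_commute)
  hence "P ^ 2 dvd ?T" using absorb by (metis coprime_dvd_mult_right_iff dvd_triv_left)
  with inv_square_inverse[OF assms(1,2), of r]
  have "[k ^ 2 * inv_square p r k * ?T = 1 * ?T] (mod P * P ^ 2)"
    unfolding P_def[symmetric] by (rule cong_mult_of_dvd)
  moreover have "k ^ 2 * inv_square p r k * ?T = P ^ 2 * (n1 * n3) * (?C * inv_square p r k)"
    using arg_cong[OF absorb, of "\<lambda>x. x * inv_square p r k"] by (simp only: mult_ac)
  ultimately have "[P ^ 2 * (n1 * n3) * (?C * inv_square p r k) = ?T] (mod P * P ^ 2)" by simp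
  thus ?thesis by (simp only: cong_sym_eq mult.commute[of P])
qed

lemma sum_A_term_nonmultiples_dvd:
  assumes p: "prime p" "5 \<le> p"
  shows "p ^ (3 * r) dvd (\<Sum>k\<in>nonmultiples p (p ^ r * a) (p ^ r * b).
    A_term (p ^ r * n1) (p ^ r * n2) (p ^ r * n3) (p ^ r * n4) k)"
proof -
  define P where "P = p ^ r"
  let ?I = "nonmultiples p (P * a) (P * b)"
  let ?T = "A_term (P * n1) (P * n2) (P * n3) (P * n4)"
  define D where
    "D k = absorbed_term (P * n1) (P * n2) (P * n3) (P * n4) (k - 1) * inv_square p r k" for k
  have "0 < p" using p(2) by simp
  have "P dvd (\<Sum>k\<in>{P * a<..P * b}. D k)"
    unfolding P_def D_def by (rule sum_absorbed_term_inv_square_dvd[OF p])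
  moreover have "P dvd (\<Sum>j\<in>{P * a div p<..P * b div p}. D (p * j))"
    unfolding P_def D_def by (intro dvd_sum dvd_mult inv_square_multiple[OF p(1)] dvd_triv_left)
  ultimately have "P dvd (\<Sum>k\<in>?I. D k)"
    using sum.split_multiples[OF \<open>0 < p\<close>, of D "P * a" "P * b"] by (simp add: dvd_add_right_iff)
  hence "P ^ 2 * P dvd P ^ 2 * (n1 * n3) * (\<Sum>k\<in>?I. D k)" by (intro mult_dvd_mono dvd_mult2 dvd_refl)
  moreover have "[(\<Sum>k\<in>?I. ?T k) = (\<Sum>k\<in>?I. P ^ 2 * (n1 * n3) * D k)] (mod P ^ 2 * P)"
    unfolding P_def D_def
    by (intro cong_sum A_term_nonmultiple_cong p(1)) (simp add: nonmultiples_def)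
  ultimately have "P ^ 2 * P dvd (\<Sum>k\<in>?I. ?T k)"
    unfolding sum_distrib_left[symmetric] using cong_dvd_iff by blast
  moreover have "p ^ (3 * r) = P ^ 2 * P"
    by (simp add: P_def mult.commute flip: power_mult power_add)
  ultimately show ?thesis by (simp only: P_def)
qed

theorem theorem1p2:
  fixes p :: nat and r :: nat and n1 n2 n3 n4 :: int
  assumes "prime p" and "p \<ge> 5" and "r \<ge> 1"
  shows "[A (int p ^ r * n1) (int p ^ r * n2) (int p ^ r * n3) (int p ^ r * n4)
          = A (int p ^ (r - 1) * n1) (int p ^ (r - 1) * n2) (int p ^ (r - 1) * n3) (int p ^ (r - 1) * n4)]
         (mod (int p ^ (3 * r)))"
proof -
  define L where "L = \<bar>n1\<bar> + \<bar>n2\<bar> + 1"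
  define T where
    "T s = A_term (int p ^ s * n1) (int p ^ s * n2) (int p ^ s * n3) (int p ^ s * n4)" for s
  have p: "prime (int p)" "5 \<le> int p" "0 < int p" using assms(1,2) by simp_all
  obtain q where r: "r = Suc q" using assms(3) by (cases r) auto
  have A_eq: "A (int p ^ s * n1) (int p ^ s * n2) (int p ^ s * n3) (int p ^ s * n4) =
      (\<Sum>k\<in>{int p ^ s * (- L)<..int p ^ s * L}. T s k)" for s
    unfolding T_def using p(3) by (intro A_scaled_eq_sum) (simp_all add: L_def)
  have "[(\<Sum>k\<in>{int p ^ q * (- L)<..int p ^ q * L}. T r (int p * k)) +
      (\<Sum>k\<in>nonmultiples (int p) (int p ^ r * (- L)) (int p ^ r * L). T r k) =
      (\<Sum>k\<in>{int p ^ q * (- L)<..int p ^ q * L}. T q k) + 0] (mod int p ^ (3 * r))"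
  proof (intro cong_add cong_sum)
    show "[T r (int p * k) = T q k] (mod int p ^ (3 * r))" for k
      using A_term_mult_cong[OF p(1,2), of q "int p ^ q * n1" "int p ^ q * n2" "int p ^ q * n3"
          "int p ^ q * n4" k] by (simp add: T_def r mult.assoc)
  qed (use sum_A_term_nonmultiples_dvd[OF p(1,2)] in \<open>simp only: cong_0_iff T_def\<close>)
  moreover have "int p ^ r * x div int p = int p ^ q * x" "r - 1 = q" for x
    using p(3) by (simp_all add: r)
  ultimately show ?thesis
    unfolding A_eq by (subst sum.split_multiples[OF p(3), of "T r"]) (simp only: add_0_right)
qed

end
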